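(* Let $f:2^{\mathcal U}\to\mathbb{R}_{\ge0}$ be submodular on a ground set $\mathcal U$ with $|\mathcal U|=n$, given by a value oracle, let $k$ be a positive integer, $0<\epsilon<1$, and $O\in\arg\max_{S\subseteq\mathcal U,|S|\le k}f(S)$. Run the following algorithm on input $(f,k,\epsilon)$. Let $M=\max_{x\in\mathcal U}f(\{x\})$, $A\leftarrow\emptyset$, $B\leftarrow\emptyset$, $\tau_1\leftarrow M$, $\tau_2\leftarrow M$. For $i=1,\dots,k$: (a) while $\tau_1\ge\epsilon M/k$ and $|A|<k$: if some $a\in\mathcal U\setminus(A\cup B)$ has $\Delta(a\mid A)\ge\tau_1$, add one such $a$ to $A$ and exit this while loop; otherwise set $\tau_1\leftarrow(1-\epsilon)\tau_1$. (b) while $\tau_2\ge\epsilon M/k$ and $|B|<k$: if some $b\in\mathcal U\setminus(A\cup B)$ has $\Delta(b\mid B)\ge\tau_2$, add one such $b$ to $B$ and exit this while loop; otherwise set $\tau_2\leftarrow(1-\epsilon)\tau_2$. Return $S\in\arg\max\{f(A),f(B)\}$. Then the algorithm makes $O(n\log(k)/\epsilon)$ oracle queries and returns $S$ with $f(S)\ge(\frac14-\epsilon)f(O)$.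
   Context: A set function $f$ is submodular if $f(X)+f(Y)\ge f(X\cup Y)+f(X\cap Y)$ for all $X,Y$; $f$ is not assumed monotone. $\Delta(x\mid Y)=f(Y\cup\{x\})-f(Y)$. Query complexity counts evaluations of $f$.
   Formalization: The query bound is proved for k ≥ 2 (log 1 = 0), with oracle answers stored and elements rejected at the current or a lower threshold not re-tested; termination is proved for M > 0 (for M = 0 the loops may run forever); the ground set is nonempty. *)

theory Defs
  imports Complex_Main
begin

definition submodular_on :: "'a set \<Rightarrow> ('a set \<Rightarrow> real) \<Rightarrow> bool" where
  "submodular_on U f \<longleftrightarrow>
     (\<forall>X Y. X \<subseteq> U \<longrightarrow> Y \<subseteq> U \<longrightarrow> f X + f Y \<ge> f (X \<union> Y) + f (X \<inter> Y))"

definition marginal :: "('a set \<Rightarrow> real) \<Rightarrow> 'a \<Rightarrow> 'a set \<Rightarrow> real" where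
  "marginal f x Y = f (Y \<union> {x}) - f Y"

definition max_singleton :: "'a set \<Rightarrow> ('a set \<Rightarrow> real) \<Rightarrow> real" where
  "max_singleton U f = Max ((\<lambda>x. f {x}) ` U)"

text \<open>
  The algorithm is a transition system whose states carry the log of all evaluations of \<open>f\<close>
  made so far (most recent first); the number of oracle queries is the length of this log.
  Answers are stored, so a set that is already in the log is not evaluated again.
\<close>

definition ask :: "'a set \<Rightarrow> 'a set list \<Rightarrow> 'a set list" where
  "ask S Q = (if S \<in> set Q then Q else S # Q)"

definition ask_marginal :: "'a \<Rightarrow> 'a set \<Rightarrow> 'a set list \<Rightarrow> 'a set list" where
  "ask_marginal x X Q = ask (X \<union> {x}) (ask X Q)"

text \<open>
  The stored answers already show that the marginal gain of \<open>x\<close> over \<open>X\<close> is below \<open>\<tau>\<close>: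
  it was below \<open>\<tau>\<close> over some subset of \<open>X\<close>, and marginal gains of a submodular function
  only decrease.
\<close>

definition ruled_out ::
    "('a set \<Rightarrow> real) \<Rightarrow> 'a set list \<Rightarrow> 'a set \<Rightarrow> real \<Rightarrow> 'a \<Rightarrow> bool" where
  "ruled_out f Q X \<tau> x \<longleftrightarrow>
     (\<exists>Z. Z \<subseteq> X \<and> Z \<in> set Q \<and> Z \<union> {x} \<in> set Q \<and> marginal f x Z < \<tau>)"

lemma ruled_out_marginal_less:
  assumes "submodular_on U f" "X \<subseteq> U" "x \<in> U - X" "ruled_out f Q X \<tau> x"
  shows "marginal f x X < \<tau>"
proof -
  obtain Z where Z: "Z \<subseteq> X" "marginal f x Z < \<tau>"
    using assms(4) by (auto simp: ruled_out_def)
  have eqs: "X \<union> (Z \<union> {x}) = X \<union> {x}" "X \<inter> (Z \<union> {x}) = Z"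
    using Z(1) assms(3) by auto
  have "Z \<union> {x} \<subseteq> U"
    using assms(2,3) Z(1) by auto
  then have "f X + f (Z \<union> {x}) \<ge> f (X \<union> (Z \<union> {x})) + f (X \<inter> (Z \<union> {x}))"
    using assms(1,2) by (simp only: submodular_on_def)
  then have "f X + f (Z \<union> {x}) \<ge> f (X \<union> {x}) + f Z"
    by (simp only: eqs)
  then show ?thesis
    using Z(2) by (simp only: marginal_def)
qed

text \<open>
  One step of a while loop that grows \<open>X\<close> with threshold \<open>\<tau>\<close>, the other solution being \<open>Y\<close>.
  The test whether some element of \<open>U - (X \<union> Y)\<close> has gain at least \<open>\<tau>\<close> evaluates, in an
  arbitrary order, candidates that are not ruled out yet, until one is accepted (\<open>add\<close>) or all
  are ruled out (\<open>lower\<close>). The Boolean tells whether the while loop is left.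
\<close>

inductive loop_step ::
    "'a set \<Rightarrow> ('a set \<Rightarrow> real) \<Rightarrow> nat \<Rightarrow> real \<Rightarrow> 'a set \<Rightarrow>
     'a set \<times> real \<times> 'a set list \<Rightarrow> bool \<Rightarrow> 'a set \<times> real \<times> 'a set list \<Rightarrow> bool"
  for U f k \<epsilon> Y where
  exit: "\<not> (\<tau> \<ge> \<epsilon> * max_singleton U f / real k \<and> card X < k) \<Longrightarrow>
     loop_step U f k \<epsilon> Y (X, \<tau>, Q) True (X, \<tau>, Q)"
| add: "\<tau> \<ge> \<epsilon> * max_singleton U f / real k \<Longrightarrow> card X < k \<Longrightarrow>
     x \<in> U - (X \<union> Y) \<Longrightarrow> \<not> ruled_out f Q X \<tau> x \<Longrightarrow> marginal f x X \<ge> \<tau> \<Longrightarrow>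
     loop_step U f k \<epsilon> Y (X, \<tau>, Q) True (X \<union> {x}, \<tau>, ask_marginal x X Q)"
| reject: "\<tau> \<ge> \<epsilon> * max_singleton U f / real k \<Longrightarrow> card X < k \<Longrightarrow>
     x \<in> U - (X \<union> Y) \<Longrightarrow> \<not> ruled_out f Q X \<tau> x \<Longrightarrow> marginal f x X < \<tau> \<Longrightarrow>
     loop_step U f k \<epsilon> Y (X, \<tau>, Q) False (X, \<tau>, ask_marginal x X Q)"
| lower: "\<tau> \<ge> \<epsilon> * max_singleton U f / real k \<Longrightarrow> card X < k \<Longrightarrow>
     \<forall>x \<in> U - (X \<union> Y). ruled_out f Q X \<tau> x \<Longrightarrow>
     loop_step U f k \<epsilon> Y (X, \<tau>, Q) False (X, (1 - \<epsilon>) * \<tau>, Q)"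

text \<open>\<open>LoopA i\<close> and \<open>LoopB i\<close>: inside loop (a) resp. (b) of the \<open>i\<close>-th round of the for loop.\<close>

datatype 'a control = LoopA nat | LoopB nat | Returned "'a set"

record 'a state =
  control :: "'a control"
  solA :: "'a set"
  solB :: "'a set"
  thr1 :: real
  thr2 :: real
  queries :: "'a set list"

inductive step ::
    "'a set \<Rightarrow> ('a set \<Rightarrow> real) \<Rightarrow> nat \<Rightarrow> real \<Rightarrow> 'a state \<Rightarrow> 'a state \<Rightarrow> bool"
  for U f k \<epsilon> where
  loopA: "control s = LoopA i \<Longrightarrow> i \<le> k \<Longrightarrow>
     loop_step U f k \<epsilon> (solB s) (solA s, thr1 s, queries s) left (X, \<tau>, Q) \<Longrightarrow>
     step U f k \<epsilon> s
       (s\<lparr>control := (if left then LoopB i else LoopA i), solA := X, thr1 := \<tau>, queries := Q\<rparr>)"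
| loopB: "control s = LoopB i \<Longrightarrow>
     loop_step U f k \<epsilon> (solA s) (solB s, thr2 s, queries s) left (X, \<tau>, Q) \<Longrightarrow>
     step U f k \<epsilon> s
       (s\<lparr>control := (if left then LoopA (i + 1) else LoopB i), solB := X, thr2 := \<tau>,
          queries := Q\<rparr>)"
| return: "control s = LoopA i \<Longrightarrow> i > k \<Longrightarrow>
     is_arg_max f (\<lambda>X. X \<in> {solA s, solB s}) S \<Longrightarrow>
     step U f k \<epsilon> s
       (s\<lparr>control := Returned S, queries := ask (solB s) (ask (solA s) (queries s))\<rparr>)"

text \<open>The initial log accounts for the evaluations that determine \<open>max_singleton U f\<close>.\<close>

definition initial :: "'a set \<Rightarrow> ('a set \<Rightarrow> real) \<Rightarrow> 'a state \<Rightarrow> bool" where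
  "initial U f s \<longleftrightarrow>
     (\<exists>xs. distinct xs \<and> set xs = U \<and>
        s = \<lparr>control = LoopA 1, solA = {}, solB = {},
             thr1 = max_singleton U f, thr2 = max_singleton U f,
             queries = map (\<lambda>x. {x}) xs\<rparr>)"

definition reachable ::
    "'a set \<Rightarrow> ('a set \<Rightarrow> real) \<Rightarrow> nat \<Rightarrow> real \<Rightarrow> 'a state \<Rightarrow> bool" where
  "reachable U f k \<epsilon> s \<longleftrightarrow> (\<exists>s0. initial U f s0 \<and> (step U f k \<epsilon>)\<^sup>*\<^sup>* s0 s)"

text \<open>Every maximal run is finite and ends by returning a set.\<close>

definition always_returns ::
    "'a set \<Rightarrow> ('a set \<Rightarrow> real) \<Rightarrow> nat \<Rightarrow> real \<Rightarrow> bool" where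
  "always_returns U f k \<epsilon> \<longleftrightarrow>
     \<not> (\<exists>\<sigma> :: nat \<Rightarrow> 'a state. initial U f (\<sigma> 0) \<and> (\<forall>j. step U f k \<epsilon> (\<sigma> j) (\<sigma> (Suc j)))) \<and>
     (\<forall>s. reachable U f k \<epsilon> s \<longrightarrow>
        (\<exists>S. control s = Returned S) \<or> (\<exists>s'. step U f k \<epsilon> s s'))"

end

theory Submission
  imports Defs
begin

text \<open>
  Approximation. Let \<open>a\<^sub>1, a\<^sub>2, \<dots>\<close> and \<open>b\<^sub>1, b\<^sub>2, \<dots>\<close> be the elements of \<open>A\<close> and \<open>B\<close> in the order of
  insertion. Since \<open>A\<close> and \<open>B\<close> are disjoint, \<open>f(O) \<le> f(O \<union> A) + f(O \<union> B)\<close>. When \<open>a\<^sub>j\<close> is chosen,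
  \<open>b\<^sub>j\<close> is still available, and when \<open>b\<^sub>j\<close> is chosen, \<open>a\<^sub>j\<^sub>+\<^sub>1\<close> is; so the gain of \<open>b\<^sub>j\<close> over \<open>A\<close> is
  charged to \<open>a\<^sub>j\<close> and the gain of \<open>a\<^sub>j\<^sub>+\<^sub>1\<close> over \<open>B\<close> to \<open>b\<^sub>j\<close>. Only \<open>a\<^sub>1\<close> has no partner. To repair this,
  take the longest prefix of \<open>a\<^sub>1, b\<^sub>1, a\<^sub>2, b\<^sub>2, \<dots>\<close> that lies in \<open>O\<close>, and charge its elements to
  themselves; because the next element is not in \<open>O\<close>, the charges of the remaining elements of \<open>O\<close>
  stay clear of the prefix. Slots that are never filled have gain at most \<open>\<epsilon>M/k\<close>.

  Queries. An element is rejected at most once per threshold value, which gives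
  \<open>O(n + n ln(k/\<epsilon>)/\<epsilon>)\<close> queries; since answers are stored, there are also only \<open>O(kn)\<close> of them.
  The first bound is good for \<open>\<epsilon> \<ge> 1/k\<close>, the second for \<open>\<epsilon> < 1/k\<close>.
\<close>

section \<open>Auxiliary facts: an assignment inequality and the query log\<close>

text \<open>The elements of \<open>T1\<close> come with pairwise different slots, while the others
  fit into every slot; by cardinality they can be injected into the slots left free. Slots that are
  not hit contribute nonnegative values.\<close>

lemma sum_le_sum_slots:
  fixes g :: "'b \<Rightarrow> real" and \<alpha> :: "'c \<Rightarrow> real"
  assumes fin: "finite I" "finite T" and card: "card T \<le> card I"
    and T1: "T1 \<subseteq> T" "inj_on s T1" "s ` T1 \<subseteq> I" "\<And>x. x \<in> T1 \<Longrightarrow> g x \<le> \<alpha> (s x)"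
    and rest: "\<And>x j. x \<in> T - T1 \<Longrightarrow> j \<in> I \<Longrightarrow> g x \<le> \<alpha> j"
    and nonneg: "\<And>j. j \<in> I \<Longrightarrow> 0 \<le> \<alpha> j"
  shows "sum g T \<le> sum \<alpha> I"
proof -
  have fT1: "finite T1"
    using T1(1) fin(2) finite_subset by blast
  have "card (T - T1) \<le> card (I - s ` T1)"
    using card T1 fT1 by (simp add: card_Diff_subset card_image)
  then obtain t where t: "t ` (T - T1) \<subseteq> I - s ` T1" "inj_on t (T - T1)"
    using card_le_inj[of "T - T1" "I - s ` T1"] fin by auto
  have "sum g T = sum g T1 + sum g (T - T1)"
    using T1(1) fin(2) sum.subset_diff[of T1 T g] by simp
  also have "\<dots> \<le> (\<Sum>x\<in>T1. \<alpha> (s x)) + (\<Sum>x\<in>T - T1. \<alpha> (t x))"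
    using T1(4) rest t(1) by (intro add_mono sum_mono) blast+
  also have "\<dots> = sum \<alpha> (s ` T1) + sum \<alpha> (t ` (T - T1))"
    using T1(2) t(2) by (simp add: sum.reindex)
  also have "\<dots> = sum \<alpha> (s ` T1 \<union> t ` (T - T1))"
    using t(1) fin fT1 by (intro sum.union_disjoint[symmetric]) auto
  also have "\<dots> \<le> sum \<alpha> I"
    using t(1) T1(3) fin nonneg by (intro sum_mono2) auto
  finally show ?thesis .
qed

text \<open>Keeps \<open>ln k\<close> away from 0 for \<open>k \<ge> 2\<close>, so that additive
  constants can be absorbed into multiples of \<open>ln k\<close>.\<close>

lemma ln_two_ge_half: "1 / 2 \<le> ln (2 :: real)"
  using ln_le_minus_one[of "1 / 2 :: real"] by (simp add: ln_div)

lemma length_ask_le: "length (ask S Q) \<le> length Q + 1"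
  by (simp add: ask_def)

lemma set_ask [simp]: "set (ask S Q) = insert S (set Q)"
  by (auto simp: ask_def)

lemma distinct_ask: "distinct Q \<Longrightarrow> distinct (ask S Q)"
  by (simp add: ask_def)

lemma length_ask_marginal_le: "length (ask_marginal x X Q) \<le> length Q + 2"
  using length_ask_le[of "X \<union> {x}" "ask X Q"] length_ask_le[of X Q]
  by (simp add: ask_marginal_def)

lemma set_ask_marginal [simp]:
  "set (ask_marginal x X Q) = insert (X \<union> {x}) (insert X (set Q))"
  by (simp add: ask_marginal_def)

lemma distinct_ask_marginal: "distinct Q \<Longrightarrow> distinct (ask_marginal x X Q)"
  by (simp add: ask_marginal_def distinct_ask)

text \<open>A witness \<open>Z\<close> survives growth of the solution and of the log, so at a fixed
  threshold a rejected candidate stays rejected.\<close>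

lemma ruled_out_mono:
  assumes "ruled_out f Q X \<tau> x" "X \<subseteq> X'" "set Q \<subseteq> set Q'"
  shows "ruled_out f Q' X' \<tau> x"
  using assms unfolding ruled_out_def by blast

lemma ruled_out_ask_marginal:
  "marginal f x X < \<tau> \<Longrightarrow> ruled_out f (ask_marginal x X Q) X \<tau> x"
  unfolding ruled_out_def by auto

section \<open>Setting and consequences of submodularity\<close>

locale twin_greedy =
  fixes U :: "'a set" and f :: "'a set \<Rightarrow> real" and k :: nat and \<epsilon> :: real
  assumes finite_U: "finite U" and U_nonempty: "U \<noteq> {}"
    and f_nonneg: "X \<subseteq> U \<Longrightarrow> 0 \<le> f X"
    and submodular: "submodular_on U f"
    and k_pos: "k \<ge> 1" and eps_pos: "0 < \<epsilon>" and eps_less_1: "\<epsilon> < 1"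
begin

definition M :: real where "M = max_singleton U f"

definition \<theta> :: real where "\<theta> = \<epsilon> * M / real k"

lemma singleton_le_M: "x \<in> U \<Longrightarrow> f {x} \<le> M"
  unfolding M_def max_singleton_def using finite_U by auto

lemma M_attained: "\<exists>x \<in> U. f {x} = M"
proof -
  have "M \<in> (\<lambda>x. f {x}) ` U"
    unfolding M_def max_singleton_def using finite_U U_nonempty by (intro Max_in) auto
  then show ?thesis by auto
qed

lemma M_nonneg: "0 \<le> M"
  using M_attained f_nonneg by force

lemma theta_nonneg: "0 \<le> \<theta>"
  unfolding \<theta>_def using M_nonneg eps_pos by simp

lemma submodularD:
  "X \<subseteq> U \<Longrightarrow> Y \<subseteq> U \<Longrightarrow> f (X \<union> Y) + f (X \<inter> Y) \<le> f X + f Y"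
  using submodular unfolding submodular_on_def by blast

lemma marginal_antimono:
  assumes "X \<subseteq> Y" "Y \<subseteq> U" "x \<in> U - Y"
  shows "marginal f x Y \<le> marginal f x X"
proof -
  have "Y \<union> (X \<union> {x}) = Y \<union> {x}" "Y \<inter> (X \<union> {x}) = X"
    using assms by auto
  then show ?thesis
    using submodularD[of Y "X \<union> {x}"] assms by (force simp: marginal_def)
qed

text \<open>Add the elements of \<open>T\<close> one at a time; by diminishing returns each gain is
  at most the gain over \<open>X\<close> alone.\<close>

lemma union_le_sum_marginals:
  assumes "finite T" "T \<subseteq> U" "X \<subseteq> U" "T \<inter> X = {}"
  shows "f (X \<union> T) \<le> f X + (\<Sum>x\<in>T. marginal f x X)"
  using assms
proof (induction T rule: finite_induct)
  case (insert x T)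
  have "marginal f x (X \<union> T) \<le> marginal f x X"
    using insert by (intro marginal_antimono) auto
  then have "f (X \<union> insert x T) \<le> f (X \<union> T) + marginal f x X"
    by (simp add: marginal_def)
  then show ?case
    using insert by simp
qed simp

subsection \<open>Termination\<close>

text \<open>The number of lowerings after which the loop guard fails. For \<open>M = 0\<close> we
  have \<theta> = 0 and a nonnegative threshold never gets below it, so the measure is meaningful
  only for \<open>M > 0\<close>.\<close>

definition level :: "real \<Rightarrow> nat" where
  "level \<tau> = (LEAST n. (1 - \<epsilon>) ^ n * \<tau> < \<theta>)"

lemma level_decreases:
  assumes "M > 0" "\<theta> \<le> \<tau>"
  shows "level ((1 - \<epsilon>) * \<tau>) < level \<tau>"
proof -
  have "\<theta> > 0"
    unfolding \<theta>_def using assms(1) eps_pos k_pos by simp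
  then have "\<tau> > 0"
    using assms(2) by linarith
  obtain n where "(1 - \<epsilon>) ^ n < \<theta> / \<tau>"
    using real_arch_pow_inv[of "\<theta> / \<tau>" "1 - \<epsilon>"] \<open>\<theta> > 0\<close> \<open>\<tau> > 0\<close> eps_pos by auto
  then have "(1 - \<epsilon>) ^ n * \<tau> < \<theta>"
    using \<open>\<tau> > 0\<close> by (simp add: field_simps)
  then have level: "(1 - \<epsilon>) ^ level \<tau> * \<tau> < \<theta>"
    unfolding level_def by (rule LeastI)
  then have "level \<tau> \<noteq> 0"
    using assms(2) by (cases "level \<tau>") auto
  then obtain m where m: "level \<tau> = Suc m"
    using not0_implies_Suc by blast
  have "(1 - \<epsilon>) ^ m * ((1 - \<epsilon>) * \<tau>) < \<theta>"
    using level m by (simp add: mult_ac)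
  then have "level ((1 - \<epsilon>) * \<tau>) \<le> m"
    unfolding level_def by (rule Least_le)
  then show ?thesis
    using m by simp
qed

text \<open>Counted over all of \<open>U\<close>, so that the measure does not depend on the other
  solution.\<close>

definition open_candidates :: "'a set \<Rightarrow> 'a set list \<Rightarrow> real \<Rightarrow> nat" where
  "open_candidates X Q \<tau> = card {x \<in> U. \<not> ruled_out f Q X \<tau> x}"

lemma open_candidates_decreases:
  assumes "x \<in> U" "\<not> ruled_out f Q X \<tau> x" "marginal f x X < \<tau>"
  shows "open_candidates X (ask_marginal x X Q) \<tau> < open_candidates X Q \<tau>"
  unfolding open_candidates_def
proof (rule psubset_card_mono)
  show "finite {x \<in> U. \<not> ruled_out f Q X \<tau> x}"
    using finite_U by simp
  show "{y \<in> U. \<not> ruled_out f (ask_marginal x X Q) X \<tau> y} \<subset> {y \<in> U. \<not> ruled_out f Q X \<tau> y}"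
    using assms ruled_out_ask_marginal[OF assms(3), of Q]
      ruled_out_mono[of f Q X \<tau> _ X "ask_marginal x X Q"] by auto
qed

lemma loop_step_decreases:
  assumes "M > 0" "loop_step U f k \<epsilon> Y (X, \<tau>, Q) False (X', \<tau>', Q')"
  shows "level \<tau>' < level \<tau> \<or>
    \<tau>' = \<tau> \<and> X' = X \<and> open_candidates X' Q' \<tau>' < open_candidates X Q \<tau>"
  using assms(2)
proof cases
  case (reject x)
  then show ?thesis
    using open_candidates_decreases by auto
next
  case lower
  then show ?thesis
    using level_decreases[OF assms(1)] by (simp add: \<theta>_def M_def)
qed simp_all

lemma loop_step_exists: "\<exists>left X' \<tau>' Q'. loop_step U f k \<epsilon> Y (X, \<tau>, Q) left (X', \<tau>', Q')"
proof (cases "\<tau> \<ge> \<epsilon> * max_singleton U f / real k \<and> card X < k")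
  case running: True
  show ?thesis
  proof (cases "\<forall>x \<in> U - (X \<union> Y). ruled_out f Q X \<tau> x")
    case True
    then show ?thesis
      using running loop_step.lower by blast
  next
    case False
    then obtain x where "x \<in> U - (X \<union> Y)" "\<not> ruled_out f Q X \<tau> x"
      by blast
    then show ?thesis
      using running loop_step.add[of \<epsilon> U f k \<tau> X x Y Q] loop_step.reject[of \<epsilon> U f k \<tau> X x Y Q]
      by (meson not_le)
  qed
next
  case False
  then show ?thesis
    using loop_step.exit by blast
qed

text \<open>The successive values at \<open>LoopA i\<close>, \<open>LoopB i\<close>,
  \<open>LoopA (i + 1)\<close> are \<open>2 * (k - i)\<close> plus 3, 2, 1 for
  \<open>i \<le> k\<close>. The drop from \<open>LoopB i\<close> to \<open>LoopA (i + 1)\<close>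
  survives truncated subtraction, as the transition out of \<open>LoopB i\<close> does not check
  \<open>i \<le> k\<close>.\<close>

fun control_rank :: "'a control \<Rightarrow> nat" where
  "control_rank (LoopA i) = 2 * (k + 1 - i) + 1"
| "control_rank (LoopB i) = 2 * (k - i) + 2"
| "control_rank (Returned S) = 0"

definition active_candidates :: "'a state \<Rightarrow> nat" where
  "active_candidates s = (case control s of
     LoopA i \<Rightarrow> open_candidates (solA s) (queries s) (thr1 s)
   | LoopB i \<Rightarrow> open_candidates (solB s) (queries s) (thr2 s)
   | Returned S \<Rightarrow> 0)"

definition active_level :: "'a state \<Rightarrow> nat" where
  "active_level s = (case control s of
     LoopA i \<Rightarrow> level (thr1 s) | LoopB i \<Rightarrow> level (thr2 s) | Returned S \<Rightarrow> 0)"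

text \<open>Lexicographic descent: leaving a loop or returning decreases the rank, lowering a
  threshold decreases the level, and a rejection uses up an open candidate.\<close>

lemma step_decreases:
  assumes "M > 0" "step U f k \<epsilon> s t"
  shows "(t, s) \<in> measures [control_rank \<circ> control, active_level, active_candidates]"
  using assms(2)
proof cases
  case (loopA i left X \<tau> Q)
  show ?thesis
  proof (cases left)
    case True
    then show ?thesis
      using loopA(1-3) by auto
  next
    case False
    then show ?thesis
      using loop_step_decreases[OF assms(1) loopA(4)[simplified False]]
        loopA(1-3) by (auto simp: active_level_def active_candidates_def)
  qed
next
  case (loopB i left X \<tau> Q)
  show ?thesis
  proof (cases left)
    case True
    then show ?thesis
      using loopB(1-2) by auto
  next
    case False
    then show ?thesis
      using loop_step_decreases[OF assms(1) loopB(3)[simplified False]]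
        loopB(1-2) by (auto simp: active_level_def active_candidates_def)
  qed
next
  case (return i S)
  then show ?thesis by simp
qed

lemma step_exists:
  assumes "\<nexists>S. control s = Returned S"
  shows "\<exists>t. step U f k \<epsilon> s t"
proof (cases "control s")
  case (LoopA i)
  show ?thesis
  proof (cases "i \<le> k")
    case True
    obtain left X \<tau> Q where
      "loop_step U f k \<epsilon> (solB s) (solA s, thr1 s, queries s) left (X, \<tau>, Q)"
      using loop_step_exists by blast
    then show ?thesis
      by (intro exI, rule step.loopA[OF LoopA True])
  next
    case False
    have "is_arg_max f (\<lambda>X. X \<in> {solA s, solB s})
        (if f (solA s) \<le> f (solB s) then solB s else solA s)"
      by (auto simp: is_arg_max_linorder)
    moreover have "k < i"
      using False by simp
    ultimately show ?thesis
      by (intro exI, rule step.return[OF LoopA, rotated])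
  qed
next
  case (LoopB i)
  obtain left X \<tau> Q where
    "loop_step U f k \<epsilon> (solA s) (solB s, thr2 s, queries s) left (X, \<tau>, Q)"
    using loop_step_exists by blast
  then show ?thesis
    by (intro exI, rule step.loopB[OF LoopB])
next
  case (Returned S)
  then show ?thesis
    using assms by blast
qed

lemma always_returns:
  assumes "M > 0"
  shows "always_returns U f k \<epsilon>"
proof -
  have "\<nexists>\<sigma> :: nat \<Rightarrow> 'a state. \<forall>j. step U f k \<epsilon> (\<sigma> j) (\<sigma> (Suc j))"
    using wf_no_infinite_down_chainE[OF wf_measures] step_decreases[OF assms] by metis
  then show ?thesis
    unfolding always_returns_def using step_exists by blast
qed

subsection \<open>Number of queries\<close>

definition rejected :: "'a set \<Rightarrow> real \<Rightarrow> 'a set list \<Rightarrow> 'a set" where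
  "rejected X \<tau> Q = {x \<in> U. ruled_out f Q X \<tau> x}"

lemma finite_rejected: "finite (rejected X \<tau> Q)"
  unfolding rejected_def using finite_U by simp

lemma card_rejected_le: "card (rejected X \<tau> Q) \<le> card U"
  unfolding rejected_def using finite_U by (intro card_mono) auto

lemma card_rejected_mono:
  assumes "X \<subseteq> X'" "set Q \<subseteq> set Q'"
  shows "card (rejected X \<tau> Q) \<le> card (rejected X' \<tau> Q')"
proof (rule card_mono[OF finite_rejected])
  show "rejected X \<tau> Q \<subseteq> rejected X' \<tau> Q'"
    unfolding rejected_def using ruled_out_mono[OF _ assms] by blast
qed

text \<open>
  The threshold was lowered \<open>l\<close> times. If \<open>M = 0\<close> lowering has no effect and is not counted, since
  it may then be repeated forever.
\<close>

definition lowered :: "real \<Rightarrow> nat \<Rightarrow> bool" where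
  "lowered \<tau> l \<longleftrightarrow> \<tau> = (1 - \<epsilon>) ^ l * M \<and> (l > 0 \<longrightarrow> \<epsilon> / real k \<le> (1 - \<epsilon>) ^ (l - 1))"

text \<open>Before the last lowering the factor \<open>(1 - \<epsilon>) ^ (l - 1)\<close> was still
  at least \<open>\<epsilon> / k\<close>; take logarithms and use
  \<open>ln (1 - \<epsilon>) \<le> - \<epsilon>\<close>. The summand 1 is the last lowering.\<close>

lemma lowered_bound:
  assumes "lowered \<tau> l"
  shows "real l \<le> 1 + ln (real k / \<epsilon>) / \<epsilon>"
proof (cases l)
  case 0
  have "\<epsilon> \<le> real k"
    using eps_less_1 k_pos by linarith
  then show ?thesis
    using 0 eps_pos by (simp add: divide_simps)
next
  case (Suc m)
  then have pow: "\<epsilon> / real k \<le> (1 - \<epsilon>) ^ m"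
    using assms by (simp add: lowered_def)
  have "\<epsilon> / real k > 0"
    using eps_pos k_pos by simp
  then have "ln (\<epsilon> / real k) \<le> ln ((1 - \<epsilon>) ^ m)"
    using pow by (subst ln_le_cancel_iff) auto
  also have "\<dots> = real m * ln (1 - \<epsilon>)"
    using eps_less_1 by (simp add: ln_realpow)
  also have "\<dots> \<le> real m * (- \<epsilon>)"
    using ln_le_minus_one[of "1 - \<epsilon>"] eps_less_1 by (intro mult_left_mono) auto
  finally have "real m * \<epsilon> \<le> ln (real k / \<epsilon>)"
    using eps_pos k_pos by (simp add: ln_div)
  then show ?thesis
    using Suc eps_pos by (simp add: field_simps)
qed

text \<open>An amortised count: a step asks at most two queries, paid for by a new element or a new
  rejection. A lowering asks nothing but may empty the set of rejected elements; the term
  \<open>card U * l\<close> makes up for that loss.\<close>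

lemma loop_step_queries:
  assumes "loop_step U f k \<epsilon> Y (X, \<tau>, Q) left (X', \<tau>', Q')" "X \<subseteq> U" "lowered \<tau> l"
  obtains l' where "lowered \<tau>' l'" "X' \<subseteq> U" "set Q \<subseteq> set Q'"
    "length Q' + 2 * (card X + card U * l + card (rejected X \<tau> Q)) \<le>
     length Q + 2 * (card X' + card U * l' + card (rejected X' \<tau>' Q'))"
  using assms(1)
proof cases
  case exit
  then show ?thesis
    using assms that[of l] by simp
next
  case (add x)
  have "finite X"
    using assms(2) finite_U finite_subset by blast
  then have "card X' = card X + 1"
    using add by simp
  moreover have "card (rejected X \<tau> Q) \<le> card (rejected X' \<tau>' Q')"
    unfolding add(3) using add by (intro card_rejected_mono) auto
  ultimately show ?thesis
    using add assms that[of l] length_ask_marginal_le[of x X Q] by auto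
next
  case (reject x)
  have "insert x (rejected X \<tau> Q) \<subseteq> rejected X' \<tau>' Q'"
    using reject ruled_out_ask_marginal[of f x X \<tau> Q] ruled_out_mono[of f Q X \<tau> _ X Q']
    unfolding rejected_def by auto
  then have "card (insert x (rejected X \<tau> Q)) \<le> card (rejected X' \<tau>' Q')"
    by (rule card_mono[OF finite_rejected])
  moreover have "x \<notin> rejected X \<tau> Q"
    using reject by (simp add: rejected_def)
  ultimately have "card (rejected X \<tau> Q) + 1 \<le> card (rejected X' \<tau>' Q')"
    using finite_rejected by simp
  then show ?thesis
    using reject assms that[of l] length_ask_marginal_le[of x X Q] by auto
next
  case lower
  show ?thesis
  proof (cases "M = 0")
    case True
    then have "\<tau>' = \<tau>"
      using lower assms(3) by (simp add: lowered_def)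
    then show ?thesis
      using lower(2,4) assms(2,3) that[of l] by simp
  next
    case False
    then have "M > 0"
      using M_nonneg by simp
    moreover have "M * (\<epsilon> / real k) \<le> M * (1 - \<epsilon>) ^ l"
      using lower(5) assms(3) by (simp add: lowered_def mult_ac flip: M_def)
    ultimately have "\<epsilon> / real k \<le> (1 - \<epsilon>) ^ l"
      by (rule mult_left_le_imp_le[rotated])
    then have "lowered \<tau>' (Suc l)"
      using lower assms(3) by (simp add: lowered_def)
    then show ?thesis
      using lower assms that[of "Suc l"] card_rejected_le[of X \<tau> Q] by simp
  qed
qed

fun returned :: "'a control \<Rightarrow> bool" where
  "returned (Returned S) = True"
| "returned _ = False"

text \<open>\<open>card U\<close> pays for the initial singletons, 2 for evaluating both solutions
  on return, and each solution carries the potential of \<open>loop_step_queries\<close>.\<close>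

definition few_queries :: "'a state \<Rightarrow> bool" where
  "few_queries s \<longleftrightarrow> solA s \<subseteq> U \<and> solB s \<subseteq> U \<and>
     (\<exists>l1 l2. lowered (thr1 s) l1 \<and> lowered (thr2 s) l2 \<and>
        length (queries s) \<le> card U + (if returned (control s) then 2 else 0) +
          2 * (card (solA s) + card U * l1 + card (rejected (solA s) (thr1 s) (queries s))) +
          2 * (card (solB s) + card U * l2 + card (rejected (solB s) (thr2 s) (queries s))))"

lemma few_queriesI:
  assumes "solA s \<subseteq> U" "solB s \<subseteq> U" "lowered (thr1 s) l1" "lowered (thr2 s) l2"
    "length (queries s) \<le> card U + (if returned (control s) then 2 else 0) +
       2 * (card (solA s) + card U * l1 + card (rejected (solA s) (thr1 s) (queries s))) +
       2 * (card (solB s) + card U * l2 + card (rejected (solB s) (thr2 s) (queries s)))"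
  shows "few_queries s"
  using assms unfolding few_queries_def by blast

lemma few_queries_step:
  assumes "step U f k \<epsilon> s t" "few_queries s"
  shows "few_queries t"
proof -
  obtain l1 l2 where s: "solA s \<subseteq> U" "solB s \<subseteq> U" "lowered (thr1 s) l1" "lowered (thr2 s) l2"
    "length (queries s) \<le> card U + (if returned (control s) then 2 else 0) +
       2 * (card (solA s) + card U * l1 + card (rejected (solA s) (thr1 s) (queries s))) +
       2 * (card (solB s) + card U * l2 + card (rejected (solB s) (thr2 s) (queries s)))"
    using assms(2) unfolding few_queries_def by blast
  from assms(1) show ?thesis
  proof cases
    case (loopA i left X \<tau> Q)
    obtain l' where l': "lowered \<tau> l'" "X \<subseteq> U" "set (queries s) \<subseteq> set Q"
      "length Q + 2 * (card (solA s) + card U * l1 + card (rejected (solA s) (thr1 s) (queries s)))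
       \<le> length (queries s) + 2 * (card X + card U * l' + card (rejected X \<tau> Q))"
      using loop_step_queries[OF loopA(4) s(1,3)] by blast
    \<comment> \<open>The log is shared: queries made for one solution can only enlarge the rejected
      set of the other.\<close>
    have "card (rejected (solB s) (thr2 s) (queries s)) \<le> card (rejected (solB s) (thr2 s) Q)"
      using l'(3) by (intro card_rejected_mono) auto
    then have "length Q \<le> card U + 2 * (card X + card U * l' + card (rejected X \<tau> Q)) +
        2 * (card (solB s) + card U * l2 + card (rejected (solB s) (thr2 s) Q))"
      using s(5) l'(4) loopA(2) by simp
    then show ?thesis
      using l'(1,2) s(2,4) loopA(1) by (intro few_queriesI[of t l' l2]) auto
  next
    case (loopB i left X \<tau> Q)
    obtain l' where l': "lowered \<tau> l'" "X \<subseteq> U" "set (queries s) \<subseteq> set Q"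
      "length Q + 2 * (card (solB s) + card U * l2 + card (rejected (solB s) (thr2 s) (queries s)))
       \<le> length (queries s) + 2 * (card X + card U * l' + card (rejected X \<tau> Q))"
      using loop_step_queries[OF loopB(3) s(2,4)] by blast
    have "card (rejected (solA s) (thr1 s) (queries s)) \<le> card (rejected (solA s) (thr1 s) Q)"
      using l'(3) by (intro card_rejected_mono) auto
    then have "length Q \<le> card U +
        2 * (card (solA s) + card U * l1 + card (rejected (solA s) (thr1 s) Q)) +
        2 * (card X + card U * l' + card (rejected X \<tau> Q))"
      using s(5) l'(4) loopB(2) by simp
    then show ?thesis
      using l'(1,2) s(1,3) loopB(1) by (intro few_queriesI[of t l1 l']) auto
  next
    case (return i S)
    let ?Q = "ask (solB s) (ask (solA s) (queries s))"
    have "length ?Q \<le> length (queries s) + 2"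
      using length_ask_le[of "solB s" "ask (solA s) (queries s)"]
        length_ask_le[of "solA s" "queries s"] by linarith
    moreover have "card (rejected (solA s) (thr1 s) (queries s)) \<le> card (rejected (solA s) (thr1 s) ?Q)"
      "card (rejected (solB s) (thr2 s) (queries s)) \<le> card (rejected (solB s) (thr2 s) ?Q)"
      by (intro card_rejected_mono; auto)+
    ultimately have "length ?Q \<le> card U + 2 +
        2 * (card (solA s) + card U * l1 + card (rejected (solA s) (thr1 s) ?Q)) +
        2 * (card (solB s) + card U * l2 + card (rejected (solB s) (thr2 s) ?Q))"
      using s(5) return(2) by simp
    then show ?thesis
      using s(1-4) return(1) by (intro few_queriesI[of t l1 l2]) auto
  qed
qed

lemma reachable_induct [consumes 1, case_names initial step]:
  assumes "reachable U f k \<epsilon> s"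
    and "\<And>s. initial U f s \<Longrightarrow> P s"
    and "\<And>s t. step U f k \<epsilon> s t \<Longrightarrow> P s \<Longrightarrow> P t"
  shows "P s"
proof -
  obtain s0 where "initial U f s0" "(step U f k \<epsilon>)\<^sup>*\<^sup>* s0 s"
    using assms(1) unfolding reachable_def by blast
  from this(2,1) show ?thesis
    by (induction rule: rtranclp_induct) (use assms(2,3) in blast)+
qed

lemma few_queries_reachable:
  assumes "reachable U f k \<epsilon> s"
  shows "few_queries s"
  using assms
proof (induction rule: reachable_induct)
  case (initial s)
  then obtain xs where xs: "distinct xs" "set xs = U"
    "s = \<lparr>control = LoopA 1, solA = {}, solB = {}, thr1 = M, thr2 = M, queries = map (\<lambda>x. {x}) xs\<rparr>"
    unfolding initial_def M_def by blast
  have "length xs = card U"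
    using xs(1,2) distinct_card by metis
  then show ?case
    unfolding few_queries_def xs(3) by (auto simp: lowered_def intro!: exI[of _ 0])
qed (use few_queries_step in blast)

lemma queries_le_thresholds:
  assumes "reachable U f k \<epsilon> s"
  shows "real (length (queries s)) \<le> real (card U) * (15 + 4 * (ln (real k / \<epsilon>) / \<epsilon>))"
proof -
  let ?L = "ln (real k / \<epsilon>) / \<epsilon>"
  obtain l1 l2 where s: "solA s \<subseteq> U" "solB s \<subseteq> U" "lowered (thr1 s) l1" "lowered (thr2 s) l2"
    "length (queries s) \<le> card U + (if returned (control s) then 2 else 0) +
       2 * (card (solA s) + card U * l1 + card (rejected (solA s) (thr1 s) (queries s))) +
       2 * (card (solB s) + card U * l2 + card (rejected (solB s) (thr2 s) (queries s)))"
    using few_queries_reachable[OF assms] unfolding few_queries_def by blast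
  have "card U \<ge> 1"
    using finite_U U_nonempty by (simp add: Suc_le_eq card_gt_0_iff)
  moreover have "card (solA s) \<le> card U" "card (solB s) \<le> card U"
    using s(1,2) finite_U by (auto intro: card_mono)
  moreover have "length (queries s) \<le> card U + 2 +
       2 * (card (solA s) + card U * l1 + card (rejected (solA s) (thr1 s) (queries s))) +
       2 * (card (solB s) + card U * l2 + card (rejected (solB s) (thr2 s) (queries s)))"
    using s(5) by (simp split: if_splits)
  \<comment> \<open>11 = 1 + 2 + 8: the singletons, the two final queries (as
    \<open>card U \<ge> 1\<close>), and twice the sizes of two solutions and two rejected sets. The
    summands 1 from \<open>lowered_bound\<close> then turn 11 into 15.\<close>
  ultimately have "length (queries s) \<le> 11 * card U + 2 * (card U * l1) + 2 * (card U * l2)"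
    using card_rejected_le[of "solA s" "thr1 s" "queries s"]
      card_rejected_le[of "solB s" "thr2 s" "queries s"] unfolding distrib_left by linarith
  then have "real (length (queries s)) \<le> real (11 * card U + 2 * (card U * l1) + 2 * (card U * l2))"
    by (rule of_nat_mono)
  also have "\<dots> = real (card U) * (11 + 2 * real l1 + 2 * real l2)"
    by (simp add: algebra_simps)
  also have "\<dots> \<le> real (card U) * (11 + 2 * (1 + ?L) + 2 * (1 + ?L))"
    using lowered_bound[OF s(3)] lowered_bound[OF s(4)] by (intro mult_left_mono add_mono) auto
  finally show ?thesis
    by (simp add: algebra_simps)
qed

section \<open>Counting queries by distinct sets\<close>

definition asked_over :: "'a set set \<Rightarrow> 'a set set" where
  "asked_over F = F \<union> (\<lambda>(X, x). X \<union> {x}) ` (F \<times> U)"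

lemma asked_over_mono: "F \<subseteq> G \<Longrightarrow> asked_over F \<subseteq> asked_over G"
  unfolding asked_over_def by blast

lemma in_asked_over:
  "X \<in> F \<Longrightarrow> X \<in> asked_over F"
  "X \<in> F \<Longrightarrow> x \<in> U \<Longrightarrow> insert x X \<in> asked_over F"
  unfolding asked_over_def by auto

lemma card_asked_over_le:
  assumes "finite F"
  shows "finite (asked_over F)" "card (asked_over F) \<le> card F * (card U + 1)"
proof -
  have "card ((\<lambda>(X, x). X \<union> {x}) ` (F \<times> U)) \<le> card F * card U"
    using card_image_le[of "F \<times> U"] assms finite_U by (simp add: card_cartesian_product)
  then show "card (asked_over F) \<le> card F * (card U + 1)"
    unfolding asked_over_def using card_Un_le[of F "(\<lambda>(X, x). X \<union> {x}) ` (F \<times> U)"] by simp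
  show "finite (asked_over F)"
    unfolding asked_over_def using assms finite_U by simp
qed

text \<open>\<open>F\<close> collects the values that the two solutions have taken. It starts as
  \<open>{{}}\<close>, which covers the initial singletons, and gains at most one set per
  insertion.\<close>

definition stored_queries :: "'a state \<Rightarrow> bool" where
  "stored_queries s \<longleftrightarrow> distinct (queries s) \<and>
     finite (solA s) \<and> finite (solB s) \<and> card (solA s) \<le> k \<and> card (solB s) \<le> k \<and>
     (\<exists>F. finite F \<and> solA s \<in> F \<and> solB s \<in> F \<and> card F \<le> card (solA s) + card (solB s) + 1 \<and>
        set (queries s) \<subseteq> asked_over F)"

text \<open>The parameter \<open>m\<close> stands for the size of the other solution plus 1, so that
  one lemma serves both loops.\<close>

lemma loop_step_stored:
  assumes "loop_step U f k \<epsilon> Y (X, \<tau>, Q) left (X', \<tau>', Q')"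
    and "distinct Q" "finite X" "card X \<le> k"
    and F: "finite F" "X \<in> F" "card F \<le> card X + m" "set Q \<subseteq> asked_over F"
  shows "distinct Q' \<and> finite X' \<and> card X' \<le> k \<and>
    (\<exists>G. finite G \<and> F \<subseteq> G \<and> X' \<in> G \<and> card G \<le> card X' + m \<and> set Q' \<subseteq> asked_over G)"
  using assms(1)
proof cases
  case exit
  then show ?thesis
    using assms by blast
next
  case (add x)
  have "set Q' \<subseteq> asked_over (insert X' F)"
    using add F asked_over_mono[of F "insert X' F"] in_asked_over(1)[of _ "insert X' F"] by auto
  moreover have "card (insert X' F) \<le> card X' + m"
    using add assms(3) F by (simp add: card_insert_if)
  ultimately show ?thesis
    using add assms distinct_ask_marginal
    by (intro conjI exI[of _ "insert X' F"]) auto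
next
  case (reject x)
  have "set Q' \<subseteq> asked_over F"
    using reject F in_asked_over[of X F] by auto
  then show ?thesis
    using reject assms distinct_ask_marginal by (intro conjI exI[of _ F]) auto
next
  case lower
  then show ?thesis
    using assms by blast
qed

lemma stored_queries_step:
  assumes "step U f k \<epsilon> s t" "stored_queries s"
  shows "stored_queries t"
proof -
  obtain F where F: "finite F" "solA s \<in> F" "solB s \<in> F"
    "card F \<le> card (solA s) + card (solB s) + 1" "set (queries s) \<subseteq> asked_over F"
    using assms(2) unfolding stored_queries_def by blast
  have s: "distinct (queries s)" "finite (solA s)" "finite (solB s)"
    "card (solA s) \<le> k" "card (solB s) \<le> k"
    using assms(2) unfolding stored_queries_def by blast+
  from assms(1) show ?thesis
  proof cases
    case (loopA i left X \<tau> Q)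
    then show ?thesis
      using loop_step_stored[OF loopA(4) s(1,2,4) F(1,2) _ F(5), of "card (solB s) + 1"] s F
      unfolding stored_queries_def by auto
  next
    case (loopB i left X \<tau> Q)
    then show ?thesis
      using loop_step_stored[OF loopB(3) s(1,3,5) F(1,3) _ F(5), of "card (solA s) + 1"] s F
      unfolding stored_queries_def by (auto simp: add.commute add.left_commute)
  next
    case (return i S)
    then show ?thesis
      using s F in_asked_over(1)[of _ F] unfolding stored_queries_def
      by (auto simp: distinct_ask intro!: exI[of _ F])
  qed
qed

lemma stored_queries_reachable:
  assumes "reachable U f k \<epsilon> s"
  shows "stored_queries s"
  using assms
proof (induction rule: reachable_induct)
  case (initial s)
  then obtain xs where xs: "distinct xs" "set xs = U"
    "s = \<lparr>control = LoopA 1, solA = {}, solB = {}, thr1 = M, thr2 = M, queries = map (\<lambda>x. {x}) xs\<rparr>"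
    unfolding initial_def M_def by blast
  have "set (queries s) \<subseteq> asked_over {{}}"
    using xs in_asked_over(2)[of "{}" "{{}}"] by auto
  moreover have "distinct (queries s)"
    using xs by (simp add: distinct_map inj_on_def)
  ultimately show ?case
    unfolding stored_queries_def xs(3) by (auto intro!: exI[of _ "{{}}"])
qed (use stored_queries_step in blast)

lemma queries_le_stored:
  assumes "reachable U f k \<epsilon> s" "k \<ge> 2"
  shows "length (queries s) \<le> 5 * k * card U"
proof -
  obtain F where F: "finite F" "card F \<le> card (solA s) + card (solB s) + 1"
    "set (queries s) \<subseteq> asked_over F"
    and s: "distinct (queries s)" "card (solA s) \<le> k" "card (solB s) \<le> k"
    using stored_queries_reachable[OF assms(1)] unfolding stored_queries_def by blast
  have n: "card U \<ge> 1"
    using finite_U U_nonempty by (simp add: Suc_le_eq card_gt_0_iff)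
  have "length (queries s) = card (set (queries s))"
    using s(1) distinct_card by metis
  also have "\<dots> \<le> card (asked_over F)"
    using F card_asked_over_le by (intro card_mono) auto
  also have "\<dots> \<le> card F * (card U + 1)"
    using F card_asked_over_le by blast
  also have "\<dots> \<le> (2 * k + 1) * (card U + 1)"
    using F(2) s by (intro mult_right_mono) auto
  \<comment> \<open>With \<open>n = card U\<close>, the product is \<open>2kn + 2k + n + 1\<close>;
    here \<open>2k \<le> 2kn\<close>, and each of \<open>n\<close> and 1 is at most
    \<open>kn / 2\<close> because \<open>k \<ge> 2\<close>.\<close>
  also have "\<dots> \<le> 5 * k * card U"
  proof -
    have "k \<le> k * card U" "2 * card U \<le> k * card U"
      using n assms(2) by auto
    moreover have "2 \<le> k * card U"
      using mult_le_mono[OF assms(2) n] by simp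
    moreover have "(2 * k + 1) * (card U + 1) = 2 * (k * card U) + 2 * k + card U + 1"
      "5 * k * card U = 5 * (k * card U)"
      by (simp_all add: algebra_simps)
    ultimately show ?thesis
      by linarith
  qed
  finally show ?thesis .
qed

text \<open>If \<open>\<epsilon> \<ge> 1 / k\<close>, then
  \<open>ln (k / \<epsilon>) \<le> 2 * ln k\<close>, and
  \<open>15 \<le> 30 * ln k / \<epsilon>\<close> gives 38 = 30 + 8. Otherwise
  \<open>k < 1 / \<epsilon>\<close>, and the bound \<open>5 * k * card U\<close> is already at most
  \<open>10 * card U * ln k / \<epsilon>\<close>.\<close>

lemma queries_bound:
  assumes "reachable U f k \<epsilon> s" "k \<ge> 2"
  shows "real (length (queries s)) \<le> 38 * (real (card U) * ln (real k) / \<epsilon>)"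
proof -
  have ln_k: "1 / 2 \<le> ln (real k)"
    using order_trans[OF ln_two_ge_half, of "ln (real k)"] assms(2) by simp
  show ?thesis
  proof (cases "1 / real k \<le> \<epsilon>")
    case True
    then have "ln (1 / \<epsilon>) \<le> ln (real k)"
      using eps_pos k_pos by (subst ln_le_cancel_iff) (auto simp: field_simps)
    then have "ln (real k / \<epsilon>) \<le> 2 * ln (real k)"
      using eps_pos k_pos by (simp add: ln_div)
    then have "4 * (ln (real k / \<epsilon>) / \<epsilon>) \<le> 8 * (ln (real k) / \<epsilon>)"
      using eps_pos by (simp add: field_simps)
    moreover have "15 \<le> 30 * (ln (real k) / \<epsilon>)"
      using ln_k eps_pos eps_less_1 by (simp add: field_simps)
    ultimately have "15 + 4 * (ln (real k / \<epsilon>) / \<epsilon>) \<le> 38 * (ln (real k) / \<epsilon>)"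
      by linarith
    then have "real (card U) * (15 + 4 * (ln (real k / \<epsilon>) / \<epsilon>)) \<le>
        real (card U) * (38 * (ln (real k) / \<epsilon>))"
      by (rule mult_left_mono) simp
    then show ?thesis
      using queries_le_thresholds[OF assms(1)] by (simp add: mult_ac)
  next
    case False
    have "real (length (queries s)) \<le> real (5 * k * card U)"
      using queries_le_stored[OF assms] by (rule of_nat_mono)
    also have "\<dots> = real (card U) * (5 * real k)"
      by simp
    also have "\<dots> \<le> real (card U) * (38 * (ln (real k) / \<epsilon>))"
    proof (rule mult_left_mono)
      have "real k \<le> 1 / \<epsilon>"
        using False eps_pos k_pos by (simp add: field_simps)
      also have "\<dots> \<le> 2 * (ln (real k) / \<epsilon>)"
        using ln_k eps_pos by (simp add: field_simps)
      finally have "5 * real k \<le> 10 * (ln (real k) / \<epsilon>)"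
        by simp
      moreover have "0 \<le> ln (real k) / \<epsilon>"
        using ln_k eps_pos by simp
      ultimately show "5 * real k \<le> 38 * (ln (real k) / \<epsilon>)"
        by linarith
    qed simp
    finally show ?thesis
      by (simp add: mult_ac)
  qed
qed

subsection \<open>Approximation ratio\<close>

definition gain :: "'a list \<Rightarrow> nat \<Rightarrow> real" where
  "gain xs j = marginal f (xs ! j) (set (take j xs))"

text \<open>
  The list \<open>xs\<close> is the insertion order of one solution, \<open>ys\<close> that of the other one; \<open>d\<close> is
  \<open>0\<close> for \<open>A\<close> and \<open>1\<close> for \<open>B\<close>, so that \<open>take (j + d) ys\<close> is the other solution at the time when
  \<open>xs ! j\<close> is chosen.
\<close>

definition greedy_side :: "nat \<Rightarrow> 'a list \<Rightarrow> 'a list \<Rightarrow> real \<Rightarrow> bool" where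
  "greedy_side d xs ys \<tau> \<longleftrightarrow> 0 \<le> \<tau> \<and>
     (\<forall>x \<in> U - (set xs \<union> set (take (length xs + d) ys)). (1 - \<epsilon>) * marginal f x (set xs) \<le> \<tau>) \<and>
     (\<forall>j < length xs. 0 \<le> gain xs j \<and>
        (\<forall>x \<in> U - (set (take j xs) \<union> set (take (j + d) ys)).
           (1 - \<epsilon>) * marginal f x (set (take j xs)) \<le> gain xs j))"

lemma greedy_side_append_other:
  assumes "greedy_side d xs ys \<tau>"
  shows "greedy_side d xs (ys @ [y]) \<tau>"
  using assms unfolding greedy_side_def by auto

lemma gain_append: "j < length xs \<Longrightarrow> gain (xs @ [x]) j = gain xs j"
  by (simp add: gain_def nth_append)

text \<open>When the threshold is lowered, every available gain was below its old value; this is the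
  origin of the factor \<open>1 - \<epsilon>\<close>. Diminishing returns preserve the invariant
  under insertion. The premise \<open>len\<close> ensures that, while the loop is active,
  \<open>take (length xs + d) ys\<close> is all of \<open>ys\<close>.\<close>

lemma loop_step_greedy_side:
  assumes step: "loop_step U f k \<epsilon> (set ys) (set xs, \<tau>, Q) left (X', \<tau>', Q')"
    and side: "greedy_side d xs ys \<tau>"
    and sub: "set xs \<subseteq> U" and dist: "distinct xs"
    and len: "\<theta> \<le> \<tau> \<longrightarrow> length ys \<le> length xs + d"
  obtains (stay) "X' = set xs" "greedy_side d xs ys \<tau>'" "\<not> left" "\<tau>' \<le> \<tau>" "\<theta> \<le> \<tau>"
    | (stuck) "X' = set xs" "greedy_side d xs ys \<tau>'" "left" "\<tau>' = \<tau>" "\<tau> < \<theta> \<or> k \<le> length xs"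
    | (add) x where "X' = set (xs @ [x])" "greedy_side d (xs @ [x]) ys \<tau>'" "left" "\<theta> \<le> \<tau>"
        "x \<in> U - (set xs \<union> set ys)"
  using step
proof cases
  case exit
  then show ?thesis
    using stuck side dist by (auto simp: \<theta>_def M_def distinct_card)
next
  case (add x)
  have \<tau>: "\<theta> \<le> \<tau>"
    using add by (simp add: \<theta>_def M_def)
  have all_ys: "take (length xs + d) ys = ys"
    using len \<tau> by simp
  have old: "(1 - \<epsilon>) * marginal f y (set xs) \<le> \<tau>" if "y \<in> U - (set xs \<union> set ys)" for y
    using side that unfolding greedy_side_def all_ys by blast
  have gain_x: "gain (xs @ [x]) (length xs) = marginal f x (set xs)"
    by (simp add: gain_def)
  have "0 \<le> \<tau>"
    using side by (simp add: greedy_side_def)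
  moreover have "(1 - \<epsilon>) * marginal f y (set (xs @ [x])) \<le> \<tau>"
    if "y \<in> U - (set (xs @ [x]) \<union> set (take (length (xs @ [x]) + d) ys))" for y
  proof -
    have "marginal f y (set (xs @ [x])) \<le> marginal f y (set xs)"
      using that sub add by (intro marginal_antimono) auto
    then have "(1 - \<epsilon>) * marginal f y (set (xs @ [x])) \<le> (1 - \<epsilon>) * marginal f y (set xs)"
      using eps_less_1 by (intro mult_left_mono) auto
    also have "\<dots> \<le> \<tau>"
      using that len \<tau> by (intro old) auto
    finally show ?thesis .
  qed
  moreover have "0 \<le> gain (xs @ [x]) j \<and>
        (\<forall>y \<in> U - (set (take j (xs @ [x])) \<union> set (take (j + d) ys)).
           (1 - \<epsilon>) * marginal f y (set (take j (xs @ [x]))) \<le> gain (xs @ [x]) j)"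
    if "j < length (xs @ [x])" for j
  proof (cases "j = length xs")
    \<comment> \<open>The new slot inherits the bound that held for the threshold, since the
      accepted gain is at least \<tau>.\<close>
    case True
    then show ?thesis
      using gain_x add \<open>0 \<le> \<tau>\<close> old all_ys by force
  next
    case False
    then have "j < length xs"
      using that by simp
    then show ?thesis
      using side gain_append[of j xs x] by (simp add: greedy_side_def)
  qed
  ultimately have "greedy_side d (xs @ [x]) ys \<tau>"
    unfolding greedy_side_def by blast
  then show ?thesis
    using that(3)[of x] add \<tau> by simp
next
  case (reject x)
  then show ?thesis
    using stay side by (simp add: \<theta>_def M_def)
next
  case lower
  have \<tau>: "\<theta> \<le> \<tau>"
    using lower by (simp add: \<theta>_def M_def)
  have all_ys: "take (length xs + d) ys = ys"
    using len \<tau> by simp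
  have "0 \<le> \<tau>"
    using side by (simp add: greedy_side_def)
  have "(1 - \<epsilon>) * marginal f x (set xs) \<le> (1 - \<epsilon>) * \<tau>" if "x \<in> U - (set xs \<union> set ys)" for x
  proof (rule mult_left_mono)
    have "marginal f x (set xs) < \<tau>"
      using lower(7) that sub by (intro ruled_out_marginal_less[OF submodular, of "set xs" x Q]) auto
    then show "marginal f x (set xs) \<le> \<tau>"
      by simp
  qed (use eps_less_1 in simp)
  then have "greedy_side d xs ys \<tau>'"
    using side lower(3) \<open>0 \<le> \<tau>\<close> eps_less_1 unfolding greedy_side_def all_ys by simp
  moreover have "\<tau>' \<le> \<tau>"
    using mult_right_mono[of "1 - \<epsilon>" 1 \<tau>] lower(3) \<open>0 \<le> \<tau>\<close> eps_pos by simp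
  ultimately show ?thesis
    using stay lower \<tau> by simp
qed

section \<open>Insertion orders along a run\<close>

definition orders :: "'a list \<Rightarrow> 'a list \<Rightarrow> bool" where
  "orders as bs \<longleftrightarrow> distinct as \<and> distinct bs \<and> set as \<inter> set bs = {} \<and> set as \<subseteq> U \<and> set bs \<subseteq> U"

text \<open>A solution that missed one of the first \<open>i\<close> rounds did so because its
  threshold had fallen below \<theta>. This is what later bounds the slots that are never
  filled.\<close>

definition rounds :: "'a list \<Rightarrow> nat \<Rightarrow> real \<Rightarrow> bool" where
  "rounds xs i \<tau> \<longleftrightarrow> length xs \<le> i \<and> (length xs < i \<longrightarrow> \<tau> < \<theta>)"

fun control_ok :: "'a control \<Rightarrow> 'a list \<Rightarrow> 'a list \<Rightarrow> real \<Rightarrow> real \<Rightarrow> bool" where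
  "control_ok (LoopA i) as bs \<tau>1 \<tau>2 \<longleftrightarrow>
     1 \<le> i \<and> i \<le> k + 1 \<and> rounds as (i - 1) \<tau>1 \<and> rounds bs (i - 1) \<tau>2"
| "control_ok (LoopB i) as bs \<tau>1 \<tau>2 \<longleftrightarrow>
     1 \<le> i \<and> i \<le> k \<and> rounds as i \<tau>1 \<and> rounds bs (i - 1) \<tau>2"
| "control_ok (Returned S) as bs \<tau>1 \<tau>2 \<longleftrightarrow>
     rounds as k \<tau>1 \<and> rounds bs k \<tau>2 \<and> f (set as) \<le> f S \<and> f (set bs) \<le> f S"

definition greedy_history :: "'a state \<Rightarrow> 'a list \<Rightarrow> 'a list \<Rightarrow> bool" where
  "greedy_history s as bs \<longleftrightarrow> solA s = set as \<and> solB s = set bs \<and> orders as bs \<and>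
     greedy_side 0 as bs (thr1 s) \<and> greedy_side 1 bs as (thr2 s) \<and>
     control_ok (control s) as bs (thr1 s) (thr2 s)"

lemma greedy_history_step:
  assumes "step U f k \<epsilon> s t" "greedy_history s as bs"
  shows "\<exists>as' bs'. greedy_history t as' bs'"
proof -
  have s: "solA s = set as" "solB s = set bs" "orders as bs"
    "greedy_side 0 as bs (thr1 s)" "greedy_side 1 bs as (thr2 s)"
    "control_ok (control s) as bs (thr1 s) (thr2 s)"
    using assms(2) unfolding greedy_history_def by blast+
  have o: "distinct as" "distinct bs" "set as \<inter> set bs = {}" "set as \<subseteq> U" "set bs \<subseteq> U"
    using s(3) unfolding orders_def by blast+
  from assms(1) show ?thesis
  proof cases
    case (loopA i left X \<tau> Q)
    have c: "1 \<le> i" "rounds as (i - 1) (thr1 s)" "rounds bs (i - 1) (thr2 s)"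
      using s(6) loopA(2) by auto
    \<comment> \<open>A threshold of at least \<theta> means that \<open>as\<close> missed no round,
      so it has length \<open>i - 1\<close> and \<open>bs\<close> is not longer. In loop (b)
      \<open>as\<close> may be one round ahead, whence the offset 1.\<close>
    have len: "\<theta> \<le> thr1 s \<longrightarrow> length bs \<le> length as + 0"
      using c unfolding rounds_def by force
    from loopA(4)[unfolded s(1,2)] s(4) o(4,1) len show ?thesis
    proof (cases rule: loop_step_greedy_side)
      case stay
      then have "greedy_history t as bs"
        using loopA(1-3) s o c by (auto simp: greedy_history_def rounds_def)
      then show ?thesis by blast
    next
      case stuck
      then have "greedy_history t as bs"
        using loopA(1-3) s o c by (auto simp: greedy_history_def rounds_def)
      then show ?thesis by blast
    next
      case (add x)
      then have "length as = i - 1"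
        using c unfolding rounds_def by force
      then have "greedy_history t (as @ [x]) bs"
        using add loopA(1-3) s o c greedy_side_append_other[OF s(5)]
        by (auto simp: greedy_history_def rounds_def orders_def)
      then show ?thesis by blast
    qed
  next
    case (loopB i left X \<tau> Q)
    have c: "1 \<le> i" "i \<le> k" "rounds as i (thr1 s)" "rounds bs (i - 1) (thr2 s)"
      using s(6) loopB(2) by auto
    have len: "\<theta> \<le> thr2 s \<longrightarrow> length as \<le> length bs + 1"
      using c unfolding rounds_def by force
    from loopB(3)[unfolded s(1,2)] s(5) o(5,2) len show ?thesis
    proof (cases rule: loop_step_greedy_side)
      case stay
      then have "greedy_history t as bs"
        using loopB(1-2) s o c by (auto simp: greedy_history_def rounds_def)
      then show ?thesis by blast
    next
      case stuck
      then have "greedy_history t as bs"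
        using loopB(1-2) s o c by (auto simp: greedy_history_def rounds_def)
      then show ?thesis by blast
    next
      case (add x)
      then have "length bs = i - 1"
        using c unfolding rounds_def by force
      then have "greedy_history t as (bs @ [x])"
        using add loopB(1-2) s o c greedy_side_append_other[OF s(4)]
        by (auto simp: greedy_history_def rounds_def orders_def)
      then show ?thesis by blast
    qed
  next
    case (return i S)
    then have "i = k + 1"
      using s(6) by simp
    then have "greedy_history t as bs"
      using return s unfolding greedy_history_def by (auto simp: is_arg_max_linorder)
    then show ?thesis by blast
  qed
qed

lemma greedy_side_initial: "greedy_side d [] [] M"
proof -
  have "(1 - \<epsilon>) * marginal f x {} \<le> M" if "x \<in> U" for x
  proof -
    have "marginal f x {} \<le> M"
      using singleton_le_M[OF that] f_nonneg[of "{}"] by (simp add: marginal_def)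
    then have "(1 - \<epsilon>) * marginal f x {} \<le> (1 - \<epsilon>) * M"
      using eps_less_1 by (intro mult_left_mono) auto
    also have "\<dots> \<le> M"
      using M_nonneg eps_pos by (simp add: algebra_simps)
    finally show ?thesis .
  qed
  then show ?thesis
    using M_nonneg by (simp add: greedy_side_def)
qed

lemma greedy_history_reachable:
  assumes "reachable U f k \<epsilon> s"
  shows "\<exists>as bs. greedy_history s as bs"
  using assms
proof (induction rule: reachable_induct)
  case (initial s)
  then obtain xs where s: "s = \<lparr>control = LoopA 1, solA = {}, solB = {}, thr1 = M, thr2 = M,
      queries = map (\<lambda>x. {x}) xs\<rparr>"
    unfolding initial_def M_def by blast
  have "greedy_history s [] []"
    using greedy_side_initial by (simp add: s greedy_history_def orders_def rounds_def)
  then show ?case by blast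
qed (use greedy_history_step in blast)

section \<open>Charging elements to slots\<close>

lemma sum_gain:
  assumes "p \<le> length xs"
  shows "(\<Sum>j = p..<length xs. gain xs j) = f (set xs) - f (set (take p xs))"
proof -
  have "gain xs j = f (set (take (Suc j) xs)) - f (set (take j xs))" if "j < length xs" for j
    using that by (simp add: gain_def marginal_def take_Suc_conv_app_nth)
  then have "(\<Sum>j = p..<length xs. gain xs j) =
      (\<Sum>j = p..<length xs. f (set (take (Suc j) xs)) - f (set (take j xs)))"
    by (intro sum.cong) auto
  also have "\<dots> = f (set xs) - f (set (take p xs))"
    using sum_Suc_diff'[OF assms, of "\<lambda>j. f (set (take j xs))"] by simp
  finally show ?thesis .
qed

text \<open>
  The element \<open>ys ! j\<close> is charged to slot \<open>j - d\<close>; elements outside of both solutions may be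
  charged to any slot. Slots from \<open>length xs\<close> on are worth \<open>\<theta>\<close>.
\<close>

lemma greedy_side_marginals:
  assumes side: "greedy_side d xs ys \<tau>" and xs: "orders xs ys" "rounds xs k \<tau>"
    and ys: "length ys \<le> k"
    and p: "p \<le> length xs" "set (take p xs) \<subseteq> Z"
    and slots: "\<And>j. q \<le> j \<Longrightarrow> j < length ys \<Longrightarrow> ys ! j \<in> Z \<Longrightarrow> p + d \<le> j"
    and Z: "Z \<subseteq> U" "card Z \<le> k"
  shows "(1 - \<epsilon>) * (\<Sum>x \<in> Z - (set xs \<union> set (take q ys)). marginal f x (set xs)) \<le>
    f (set xs) - f (set (take p xs)) + \<epsilon> * M"
proof -
  let ?T = "Z - (set xs \<union> set (take q ys))"
  define \<alpha> where "\<alpha> j = (if j < length xs then gain xs j else \<theta>)" for j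
  define idx where "idx y = (THE j. j < length ys \<and> ys ! j = y)" for y
  define T1 where "T1 = ?T \<inter> set ys"
  have o: "distinct xs" "distinct ys" "set xs \<inter> set ys = {}" "set xs \<subseteq> U"
    using xs(1) unfolding orders_def by blast+
  have idx_nth: "idx (ys ! j) = j" if "j < length ys" for j
    unfolding idx_def using that o(2) by (intro the_equality) (auto simp: nth_eq_iff_index_eq)
  have idx: "idx y < length ys" "ys ! idx y = y" if "y \<in> set ys" for y
    using that idx_nth by (auto simp: in_set_conv_nth)
  have idx_T1: "p + d \<le> idx y" "idx y < k" "y \<in> U - set xs" "y \<notin> set (take (idx y) ys)"
    if y: "y \<in> T1" for y
  proof -
    have y': "y \<in> set ys" "y \<in> Z" "y \<notin> set xs" "y \<notin> set (take q ys)"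
      using y unfolding T1_def by auto
    have "q \<le> idx y"
    proof (rule ccontr)
      assume "\<not> q \<le> idx y"
      then have "y \<in> set (take q ys)"
        using idx[OF y'(1)] by (metis in_set_conv_nth length_take min_less_iff_conj not_le nth_take)
      then show False
        using y'(4) by blast
    qed
    then show "p + d \<le> idx y"
      using slots[of "idx y"] idx[OF y'(1)] y'(2) by simp
    show "idx y < k" "y \<in> U - set xs"
      using idx[OF y'(1)] ys y' Z(1) by auto
    show "y \<notin> set (take (idx y) ys)"
      using idx[OF y'(1)] o(2) by (auto simp: in_set_conv_nth nth_eq_iff_index_eq)
  qed
  \<comment> \<open>An element outside \<open>xs\<close> and the first \<open>j + d\<close> entries
    of \<open>ys\<close> was available when slot \<open>j\<close> was filled; if the slot stayed
    empty, the final threshold is below \<theta>. For \<open>y = ys ! (j + d)\<close> this still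
    applies.\<close>
  have slot: "(1 - \<epsilon>) * marginal f x (set xs) \<le> \<alpha> j"
    if x: "x \<in> U - set xs" "x \<notin> set (take (j + d) ys)" and j: "j < k" for x j
  proof (cases "j < length xs")
    case True
    have "marginal f x (set xs) \<le> marginal f x (set (take j xs))"
      using x o(4) by (intro marginal_antimono) (auto dest: in_set_takeD)
    then have "(1 - \<epsilon>) * marginal f x (set xs) \<le> (1 - \<epsilon>) * marginal f x (set (take j xs))"
      using eps_less_1 by (intro mult_left_mono) auto
    also have "\<dots> \<le> gain xs j"
      using side True x unfolding greedy_side_def by (auto dest: in_set_takeD)
    finally show ?thesis
      using True by (simp add: \<alpha>_def)
  next
    case False
    then have "set (take (length xs + d) ys) \<subseteq> set (take (j + d) ys)"
      by (intro set_take_subset_set_take) simp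
    then have "(1 - \<epsilon>) * marginal f x (set xs) \<le> \<tau>"
      using side x unfolding greedy_side_def by blast
    also have "\<tau> \<le> \<theta>"
      using xs(2) False j by (simp add: rounds_def)
    finally show ?thesis
      using False by (simp add: \<alpha>_def)
  qed
  have fin: "finite Z"
    using Z(1) finite_U finite_subset by blast
  have "p \<le> k"
    using p(1) xs(2) by (simp add: rounds_def)
  have "(\<Sum>x \<in> ?T. (1 - \<epsilon>) * marginal f x (set xs)) \<le> (\<Sum>j = p..<k. \<alpha> j)"
  proof (rule sum_le_sum_slots[where ?T1.0 = T1 and s = "\<lambda>y. idx y - d"])
    \<comment> \<open>The prefix of \<open>xs\<close> uses up \<open>p\<close> elements of
      \<open>Z\<close>, so at most \<open>k - p\<close> are left to be charged to the slots from
      \<open>p\<close> on.\<close>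
    have "card (set (take p xs)) = p"
      using o(1) p(1) by (simp add: distinct_card)
    then have "card (Z - set (take p xs)) = card Z - p"
      using p(2) by (simp add: card_Diff_subset)
    moreover have "card ?T \<le> card (Z - set (take p xs))"
      using fin by (intro card_mono) (auto dest: in_set_takeD)
    ultimately show "card ?T \<le> card {p..<k}"
      using Z(2) by simp
    show "inj_on (\<lambda>y. idx y - d) T1"
    proof (rule inj_onI)
      fix y z
      assume yz: "y \<in> T1" "z \<in> T1" "idx y - d = idx z - d"
      then have "idx y = idx z"
        using idx_T1(1)[of y] idx_T1(1)[of z] by linarith
      then show "y = z"
        using yz idx(2) by (metis IntD2 T1_def)
    qed
    show "(\<lambda>y. idx y - d) ` T1 \<subseteq> {p..<k}"
      using idx_T1(1,2) by fastforce
    show "(1 - \<epsilon>) * marginal f y (set xs) \<le> \<alpha> (idx y - d)" if "y \<in> T1" for y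
      using idx_T1[OF that] by (intro slot) auto
    show "(1 - \<epsilon>) * marginal f x (set xs) \<le> \<alpha> j" if "x \<in> ?T - T1" "j \<in> {p..<k}" for x j
      using that Z(1) by (intro slot) (auto simp: T1_def dest: in_set_takeD)
    show "0 \<le> \<alpha> j" for j
      using side theta_nonneg by (simp add: \<alpha>_def greedy_side_def)
  qed (use fin in \<open>auto simp: T1_def\<close>)
  also have "\<dots> = (\<Sum>j = p..<length xs. \<alpha> j) + (\<Sum>j = length xs..<k. \<alpha> j)"
    using p(1) xs(2) by (intro sum.atLeastLessThan_concat[symmetric]) (auto simp: rounds_def)
  also have "\<dots> = f (set xs) - f (set (take p xs)) + real (k - length xs) * \<theta>"
    using sum_gain[OF p(1)] by (simp add: \<alpha>_def)
  also have "\<dots> \<le> f (set xs) - f (set (take p xs)) + real k * \<theta>"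
    using theta_nonneg by (intro add_left_mono mult_right_mono) auto
  also have "real k * \<theta> = \<epsilon> * M"
    using k_pos by (simp add: \<theta>_def)
  finally show ?thesis
    by (simp add: sum_distrib_left)
qed

text \<open>Build \<open>Z \<union> set xs\<close> from \<open>set xs\<close> by first adding the
  prefix of \<open>ys\<close>, which is charged to itself at cost \<open>f (set (take q ys))\<close>
  by disjointness and \<open>f {} \<ge> 0\<close>. The remaining elements are charged to
  slots.\<close>

lemma greedy_side_bound:
  assumes "greedy_side d xs ys \<tau>" "orders xs ys" "rounds xs k \<tau>" "length ys \<le> k"
    and "p \<le> length xs" "set (take p xs) \<subseteq> Z" "set (take q ys) \<subseteq> Z"
    and "\<And>j. q \<le> j \<Longrightarrow> j < length ys \<Longrightarrow> ys ! j \<in> Z \<Longrightarrow> p + d \<le> j"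
    and Z: "Z \<subseteq> U" "card Z \<le> k"
  shows "(1 - \<epsilon>) * (f (Z \<union> set xs) - f (set xs) - f (set (take q ys))) \<le>
    f (set xs) - f (set (take p xs)) + \<epsilon> * M"
proof -
  let ?X = "set xs" and ?P = "set (take q ys)"
  let ?T = "Z - (?X \<union> ?P)"
  have sub: "?X \<subseteq> U" "?P \<subseteq> U" "?X \<inter> ?P = {}"
    using assms(2) unfolding orders_def by (auto dest: in_set_takeD)
  have fin: "finite ?T"
    using Z(1) finite_U finite_subset by blast
  have "?X \<union> ?P \<union> ?T = Z \<union> ?X"
    using assms(7) by auto
  then have "f (Z \<union> ?X) \<le> f (?X \<union> ?P) + (\<Sum>x \<in> ?T. marginal f x (?X \<union> ?P))"
    using union_le_sum_marginals[OF fin, of "?X \<union> ?P"] Z(1) sub by fastforce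
  also have "\<dots> \<le> (f ?X + f ?P) + (\<Sum>x \<in> ?T. marginal f x ?X)"
  proof (rule add_mono)
    show "f (?X \<union> ?P) \<le> f ?X + f ?P"
      using submodularD[OF sub(1,2)] f_nonneg[of "{}"] sub(3) by simp
    show "(\<Sum>x \<in> ?T. marginal f x (?X \<union> ?P)) \<le> (\<Sum>x \<in> ?T. marginal f x ?X)"
      using sub Z(1) by (intro sum_mono marginal_antimono) auto
  qed
  finally have "f (Z \<union> ?X) - f ?X - f ?P \<le> (\<Sum>x \<in> ?T. marginal f x ?X)"
    by simp
  then have "(1 - \<epsilon>) * (f (Z \<union> ?X) - f ?X - f ?P) \<le> (1 - \<epsilon>) * (\<Sum>x \<in> ?T. marginal f x ?X)"
    using eps_less_1 by (intro mult_left_mono) auto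
  also have "\<dots> \<le> f ?X - f (set (take p xs)) + \<epsilon> * M"
    using assms by (intro greedy_side_marginals) auto
  finally show ?thesis .
qed

text \<open>Even positions \<open>n\<close> of the interleaving are \<open>as ! (n div 2)\<close>,
  odd ones \<open>bs ! (n div 2)\<close>. At the first bad \<open>n\<close>, one has
  \<open>p = q\<close> with \<open>as ! p\<close> missing or outside \<open>Z\<close>, or
  \<open>p = q + 1\<close> with \<open>bs ! q\<close> missing or outside \<open>Z\<close>. The last
  two conclusions are the slot conditions for offsets 0 and 1.\<close>

lemma interleaved_prefix:
  fixes as bs :: "'b list"
  obtains p q where "p \<le> length as" "q \<le> length bs" "set (take p as) \<subseteq> Z" "set (take q bs) \<subseteq> Z"
    "\<forall>j < length bs. q \<le> j \<longrightarrow> bs ! j \<in> Z \<longrightarrow> p \<le> j"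
    "\<forall>j < length as. p \<le> j \<longrightarrow> as ! j \<in> Z \<longrightarrow> q + 1 \<le> j"
proof -
  define good where "good n \<longleftrightarrow>
    (if even n then n div 2 < length as \<and> as ! (n div 2) \<in> Z
     else n div 2 < length bs \<and> bs ! (n div 2) \<in> Z)" for n
  define n where "n = (LEAST n. \<not> good n)"
  \<comment> \<open>The interleaving runs out of elements of \<open>as\<close> here, so the
    \<open>LEAST\<close> is attained.\<close>
  have "\<not> good (2 * length as)"
    by (simp add: good_def)
  then have n: "\<not> good n"
    unfolding n_def by (rule LeastI)
  have before: "good m" if "m < n" for m
    using not_less_Least[of m "\<lambda>n. \<not> good n"] that unfolding n_def by blast
  define p where "p = (n + 1) div 2"
  define q where "q = n div 2"
  have as: "j < length as \<and> as ! j \<in> Z" if "j < p" for j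
    using before[of "2 * j"] that by (auto simp: good_def p_def)
  have bs: "j < length bs \<and> bs ! j \<in> Z" if "j < q" for j
    using before[of "2 * j + 1"] that by (auto simp: good_def q_def)
  show thesis
  proof (rule that[of p q])
    show "p \<le> length as"
      using as[of "length as"] by (meson less_irrefl not_le)
    show "q \<le> length bs"
      using bs[of "length bs"] by (meson less_irrefl not_le)
    show "set (take p as) \<subseteq> Z" "set (take q bs) \<subseteq> Z"
      using as bs by (auto simp: in_set_conv_nth)
    have "p \<le> j" if "q \<le> j" "j < length bs" "bs ! j \<in> Z" for j
    proof (cases "even n")
      case True
      then show ?thesis
        using that by (auto simp: p_def q_def elim!: evenE)
    next
      case False
      then have "j \<noteq> q"
        using n that by (auto simp: good_def q_def)
      then show ?thesis
        using that unfolding p_def q_def by linarith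
    qed
    then show "\<forall>j < length bs. q \<le> j \<longrightarrow> bs ! j \<in> Z \<longrightarrow> p \<le> j"
      by blast
    have "q + 1 \<le> j" if "p \<le> j" "j < length as" "as ! j \<in> Z" for j
    proof (cases "even n")
      case True
      then have "j \<noteq> q"
        using n that by (auto simp: good_def q_def)
      then show ?thesis
        using that unfolding p_def q_def by linarith
    next
      case False
      then show ?thesis
        using that by (auto simp: p_def q_def elim!: oddE)
    qed
    then show "\<forall>j < length as. p \<le> j \<longrightarrow> as ! j \<in> Z \<longrightarrow> q + 1 \<le> j"
      by blast
  qed
qed

text \<open>In the sum of the two charging bounds the prefix values \<open>c\<close> and
  \<open>d\<close> cancel up to \<open>- \<epsilon> * (c + d)\<close>. Since singletons are
  feasible, \<open>M \<le> f Opt\<close>, which turns the additive loss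
  \<open>2 * \<epsilon> * M\<close> into a multiplicative one.\<close>

lemma approximation:
  assumes reach: "reachable U f k \<epsilon> s" and ret: "control s = Returned S"
    and opt: "is_arg_max f (\<lambda>S. S \<subseteq> U \<and> card S \<le> k) Opt"
  shows "(1 / 4 - \<epsilon>) * f Opt \<le> f S"
proof -
  obtain as bs where h: "greedy_history s as bs"
    using greedy_history_reachable[OF reach] by blast
  let ?A = "set as" and ?B = "set bs"
  have s: "orders as bs" "orders bs as" "greedy_side 0 as bs (thr1 s)" "greedy_side 1 bs as (thr2 s)"
    "rounds as k (thr1 s)" "rounds bs k (thr2 s)" "f ?A \<le> f S" "f ?B \<le> f S"
    using h ret unfolding greedy_history_def orders_def by auto
  have len: "length as \<le> k" "length bs \<le> k"
    using s(5,6) by (auto simp: rounds_def)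
  have sub: "?A \<subseteq> U" "?B \<subseteq> U" "?A \<inter> ?B = {}"
    using s(1) by (auto simp: orders_def)
  have Opt: "Opt \<subseteq> U" "card Opt \<le> k"
    and max: "\<And>T. T \<subseteq> U \<Longrightarrow> card T \<le> k \<Longrightarrow> f T \<le> f Opt"
    using opt by (auto simp: is_arg_max_linorder)
  obtain x where "x \<in> U" "f {x} = M"
    using M_attained by blast
  then have "M \<le> f Opt"
    using max[of "{x}"] k_pos by simp
  obtain p q where pq: "p \<le> length as" "q \<le> length bs"
    "set (take p as) \<subseteq> Opt" "set (take q bs) \<subseteq> Opt"
    "\<forall>j < length bs. q \<le> j \<longrightarrow> bs ! j \<in> Opt \<longrightarrow> p \<le> j"
    "\<forall>j < length as. p \<le> j \<longrightarrow> as ! j \<in> Opt \<longrightarrow> q + 1 \<le> j"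
    using interleaved_prefix[where as = as and bs = bs and Z = Opt] by blast
  define a b c d where "a = f ?A" and "b = f ?B"
    and "c = f (set (take p as))" and "d = f (set (take q bs))"
  have nonneg: "0 \<le> f Opt" "0 \<le> a" "0 \<le> b"
    using f_nonneg Opt(1) sub by (auto simp: a_def b_def)
  have cd: "c \<ge> 0" "d \<ge> 0"
    unfolding c_def d_def using sub by (auto intro!: f_nonneg dest: in_set_takeD)
  have "(1 - \<epsilon>) * (f (Opt \<union> ?A) - a - d) \<le> a - c + \<epsilon> * M"
    unfolding a_def c_def d_def
    using greedy_side_bound[OF s(3,1,5) len(2) pq(1,3,4)] pq(5) Opt by simp
  moreover have "(1 - \<epsilon>) * (f (Opt \<union> ?B) - b - c) \<le> b - d + \<epsilon> * M"
    unfolding b_def c_def d_def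
    using greedy_side_bound[OF s(4,2,6) len(1) pq(2,4,3)] pq(6) Opt by simp
  ultimately have "(1 - \<epsilon>) * (f (Opt \<union> ?A) + f (Opt \<union> ?B)) \<le>
      (2 - \<epsilon>) * (a + b) - \<epsilon> * (c + d) + 2 * (\<epsilon> * M)"
    by (simp add: algebra_simps)
  moreover have "(Opt \<union> ?A) \<inter> (Opt \<union> ?B) = Opt"
    using sub(3) by blast
  then have "f Opt \<le> f (Opt \<union> ?A) + f (Opt \<union> ?B)"
    using submodularD[of "Opt \<union> ?A" "Opt \<union> ?B"] f_nonneg[of "Opt \<union> ?A \<union> (Opt \<union> ?B)"] Opt(1) sub
    by simp
  then have "(1 - \<epsilon>) * f Opt \<le> (1 - \<epsilon>) * (f (Opt \<union> ?A) + f (Opt \<union> ?B))"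
    using eps_less_1 by (intro mult_left_mono) auto
  moreover have "\<epsilon> * M \<le> \<epsilon> * f Opt" "0 \<le> \<epsilon> * (c + d)"
    using \<open>M \<le> f Opt\<close> eps_pos cd by auto
  moreover have "(2 - \<epsilon>) * (a + b) \<le> (2 - \<epsilon>) * (2 * f S)"
    using s(7,8) eps_less_1 by (intro mult_left_mono) (auto simp: a_def b_def)
  ultimately have "(1 - \<epsilon>) * f Opt \<le> (2 - \<epsilon>) * (2 * f S) + 2 * (\<epsilon> * f Opt)"
    by linarith
  then have main: "(1 - 3 * \<epsilon>) * f Opt \<le> (4 - 2 * \<epsilon>) * f S"
    by (simp add: algebra_simps)
  \<comment> \<open>For \<open>\<epsilon> \<le> 1 / 4\<close> the ratio
    \<open>(1 - 3 * \<epsilon>) / (4 - 2 * \<epsilon>)\<close> is at least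
    \<open>1 / 4 - \<epsilon>\<close>; for larger \<epsilon> the claimed bound is
    nonpositive.\<close>
  show ?thesis
  proof (cases "\<epsilon> \<le> 1 / 4")
    case True
    have "(4 - 2 * \<epsilon>) * (1 / 4 - \<epsilon>) = (1 - 3 * \<epsilon>) - \<epsilon> * (3 / 2 - 2 * \<epsilon>)"
      by (simp add: algebra_simps)
    also have "\<dots> \<le> 1 - 3 * \<epsilon>"
      using True eps_pos by simp
    finally have "(4 - 2 * \<epsilon>) * (1 / 4 - \<epsilon>) * f Opt \<le> (1 - 3 * \<epsilon>) * f Opt"
      using nonneg(1) by (rule mult_right_mono)
    then have "(4 - 2 * \<epsilon>) * ((1 / 4 - \<epsilon>) * f Opt) \<le> (4 - 2 * \<epsilon>) * f S"
      using main by (simp add: mult.assoc)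
    then show ?thesis
      using eps_less_1 by (simp add: mult_le_cancel_left_pos)
  next
    case False
    then have "(1 / 4 - \<epsilon>) * f Opt \<le> 0"
      using nonneg(1) by (intro mult_nonpos_nonneg) auto
    then show ?thesis
      using nonneg s(7) by (simp add: a_def)
  qed
qed

end

text \<open>Termination is claimed for a positive largest singleton value, since at threshold 0
  lowering may repeat forever. The query bound concerns every reachable state, hence also runs that
  do not return; it asks for \<open>k \<ge> 2\<close> because \<open>ln 1 = 0\<close>.\<close>

theorem theorem4p1:
  "\<exists>C > 0. \<forall>(U :: 'a set) (f :: 'a set \<Rightarrow> real) (k :: nat) (\<epsilon> :: real) (Opt :: 'a set).
     finite U \<longrightarrow> U \<noteq> {} \<longrightarrow>
     (\<forall>X. X \<subseteq> U \<longrightarrow> f X \<ge> 0) \<longrightarrow> submodular_on U f \<longrightarrow>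
     k \<ge> 1 \<longrightarrow> 0 < \<epsilon> \<longrightarrow> \<epsilon> < 1 \<longrightarrow>
     is_arg_max f (\<lambda>S. S \<subseteq> U \<and> card S \<le> k) Opt \<longrightarrow>
       (max_singleton U f > 0 \<longrightarrow> always_returns U f k \<epsilon>) \<and>
       (k \<ge> 2 \<longrightarrow> (\<forall>s. reachable U f k \<epsilon> s \<longrightarrow>
          real (length (queries s)) \<le> C * (real (card U) * ln (real k) / \<epsilon>))) \<and>
       (\<forall>s S. reachable U f k \<epsilon> s \<longrightarrow> control s = Returned S \<longrightarrow>
          f S \<ge> (1/4 - \<epsilon>) * f Opt)"
proof -
  have "(max_singleton U f > 0 \<longrightarrow> always_returns U f k \<epsilon>) \<and>
       (k \<ge> 2 \<longrightarrow> (\<forall>s. reachable U f k \<epsilon> s \<longrightarrow>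
          real (length (queries s)) \<le> 38 * (real (card U) * ln (real k) / \<epsilon>))) \<and>
       (\<forall>s S. reachable U f k \<epsilon> s \<longrightarrow> control s = Returned S \<longrightarrow>
          f S \<ge> (1/4 - \<epsilon>) * f Opt)"
    if "finite U" "U \<noteq> {}" "\<forall>X. X \<subseteq> U \<longrightarrow> f X \<ge> 0" "submodular_on U f" "k \<ge> 1" "0 < \<epsilon>" "\<epsilon> < 1"
      and opt: "is_arg_max f (\<lambda>S. S \<subseteq> U \<and> card S \<le> k) Opt"
    for U :: "'a set" and f :: "'a set \<Rightarrow> real" and k :: nat and \<epsilon> :: real and Opt :: "'a set"
  proof -
    interpret twin_greedy U f k \<epsilon>
      using that by unfold_locales auto
    show ?thesis
      using always_returns queries_bound approximation[OF _ _ opt] by (auto simp: M_def)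
  qed
  then show ?thesis
    by (intro exI[of _ "38 :: real"] conjI) auto
qed

end
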